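(* Let $\ell\geq 0$. For every $u,v\in S_{\infty,\ell}$ there exists $w\in S_{\infty,\ell}$ with $u\preceq_D w$ and $v\preceq_D w$.
   Context: $S_\infty=\bigcup_{n\geq1}S_n$ via the inclusions $S_n\hookrightarrow S_{n+1}$, $w(1)\cdots w(n)\mapsto w(1)\cdots w(n)\,(n+1)$; $\ell(w)$ is the number of inversions and $S_{\infty,\ell}=\{w\in S_\infty:\ell(w)=\ell\}$. Schubert polynomials: with $\partial_i f=\frac{f-s_if}{x_i-x_{i+1}}$, for $w\in S_n$ set $\mathfrak{S}_{w_0}=x_1^{n-1}x_2^{n-2}\cdots x_{n-1}$ for $w_0=n\,n{-}1\cdots1$ and $\mathfrak{S}_w=\partial_i\mathfrak{S}_{ws_i}$ whenever $w(i)<w(i+1)$ (with $ws_i$ being $w$ with positions $i,i+1$ of its one-line notation swapped); this is well defined on $S_\infty$. $\mathsf{Newton}(f)$ is the convex hull of the exponent vectors of $f$, viewed in $\mathbb{R}^N$ for any $N$ at least the number of variables involved. For $u,v\in S_{\infty,\ell}$, $u\preceq_D v$ means $\mathsf{Newton}(\mathfrak{S}_u)\subseteq\mathsf{Newton}(\mathfrak{S}_v)$. *)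

theory Defs
  imports "HOL-Analysis.Analysis" "HOL-Analysis.Finite_Function_Topology"
    "HOL-Combinatorics.Permutations" "HOL-Library.Poly_Mapping"
begin

text \<open>
  Permutations are functions on \<^typ>\<open>nat\<close> that move only finitely many positive integers and fix
  \<open>0\<close>. The one-line notation of \<open>w\<close> is \<open>w 1, w 2, \<dots>\<close>. Extending a function on \<open>{1..n}\<close> by the
  identity makes the inclusions of the finite symmetric groups into each other literal inclusions
  of sets.
\<close>

definition S_inf :: "(nat \<Rightarrow> nat) set" where
  "S_inf = (\<Union>n\<in>{1..}. {w. w permutes {1..n}})"

definition perm_length :: "(nat \<Rightarrow> nat) \<Rightarrow> nat" where
  "perm_length w = card {(i, j). 1 \<le> i \<and> i < j \<and> w i > w j}"

definition S_inf_len :: "nat \<Rightarrow> (nat \<Rightarrow> nat) set" where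
  "S_inf_len l = {w \<in> S_inf. perm_length w = l}"

definition longest_perm :: "nat \<Rightarrow> nat \<Rightarrow> nat" where
  "longest_perm n i = (if 1 \<le> i \<and> i \<le> n then n + 1 - i else i)"

text \<open>
  A monomial is its exponent vector, a finitely supported function on variable indices, and a
  polynomial is the finitely supported function sending monomials to coefficients. Multiplication
  on this type is convolution. Only variables with index at least \<open>1\<close> occur in Schubert
  polynomials.
\<close>

type_synonym mpoly_int = "(nat \<Rightarrow>\<^sub>0 nat) \<Rightarrow>\<^sub>0 int"

definition Var :: "nat \<Rightarrow> mpoly_int" where
  "Var i = Poly_Mapping.single (Poly_Mapping.single i 1) 1"

text \<open>
  The inner \<^const>\<open>Poly_Mapping.map_key\<close> exchanges the exponents of the variables \<open>i\<close> and \<open>i + 1\<close>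
  in a monomial; the outer one reindexes the coefficients along this involution.
\<close>

definition swap_vars :: "nat \<Rightarrow> mpoly_int \<Rightarrow> mpoly_int" where
  "swap_vars i f =
     Poly_Mapping.map_key (Poly_Mapping.map_key (Transposition.transpose i (i + 1))) f"

text \<open>
  The quotient of \<open>f - s\<^sub>i f\<close> by \<open>x\<^sub>i - x\<^sub>i\<^sub>+\<^sub>1\<close>. It exists because the dividend vanishes for
  \<open>x\<^sub>i = x\<^sub>i\<^sub>+\<^sub>1\<close>, and it is unique because polynomials form an integral domain.
\<close>

definition divided_difference :: "nat \<Rightarrow> mpoly_int \<Rightarrow> mpoly_int" where
  "divided_difference i f = (THE g. (Var i - Var (i + 1)) * g = f - swap_vars i f)"

text \<open>
  \<open>schubert_rel n w f\<close> says that \<open>f\<close> is obtained for \<open>w\<close> by the recursion in the symmetric group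
  on \<open>{1..n}\<close> along some chain of ascents leading from \<open>w\<close> up to the longest permutation.
  Precomposing with a transposition exchanges two positions of the one-line notation.
\<close>

inductive schubert_rel :: "nat \<Rightarrow> (nat \<Rightarrow> nat) \<Rightarrow> mpoly_int \<Rightarrow> bool" for n :: nat where
  longest: "1 \<le> n \<Longrightarrow> schubert_rel n (longest_perm n) (\<Prod>i=1..n. Var i ^ (n - i))"
| ascent: "w permutes {1..n} \<Longrightarrow> 1 \<le> i \<Longrightarrow> i < n \<Longrightarrow> w i < w (i + 1) \<Longrightarrow>
    schubert_rel n (w \<circ> Transposition.transpose i (i + 1)) f \<Longrightarrow>
    schubert_rel n w (divided_difference i f)"

text \<open>
  The description is legitimate by the classical theorem that the polynomial depends neither on
  the chosen chain of ascents nor on the chosen \<open>n\<close>.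
\<close>

definition schubert :: "(nat \<Rightarrow> nat) \<Rightarrow> mpoly_int" where
  "schubert w = (THE f. \<exists>n. schubert_rel n w f)"

text \<open>
  The ambient space is the union of all \<open>\<real>\<^sup>N\<close>, the real vector space of finitely supported
  sequences, so no number of variables needs to be fixed.
\<close>

definition newton :: "mpoly_int \<Rightarrow> (nat \<Rightarrow>\<^sub>0 real) set" where
  "newton f = convex hull (Poly_Mapping.map real ` Poly_Mapping.keys f)"

definition le_D :: "(nat \<Rightarrow> nat) \<Rightarrow> (nat \<Rightarrow> nat) \<Rightarrow> bool"  (infix "\<preceq>\<^sub>D" 50) where
  "u \<preceq>\<^sub>D v \<longleftrightarrow> newton (schubert u) \<subseteq> newton (schubert v)"

end

theory Submission
  imports Defs
begin

text \<open>
  The complete homogeneous polynomial of degree \<open>l\<close> in \<open>x\<^sub>1, \<dots>, x\<^sub>m\<close> is the Schubert polynomial of the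
  permutation \<open>1, \<dots>, m - 1, m + l, m, m + 1, \<dots>\<close>, and its support consists of all monomials of
  degree \<open>l\<close> in these variables. As \<open>S\<^sub>u\<close> is homogeneous of degree \<open>\<ell>(u)\<close> in finitely many variables,
  this permutation dominates both \<open>u\<close> and \<open>v\<close> once \<open>m\<close> is large. To identify its Schubert polynomial,
  divided differences are used to descend from the longest permutation to \<open>x\<^sub>1^(m + l - 1)\<close> and
  from there along \<open>\<partial>\<^sub>k h\<^sub>j\<^sub>+\<^sub>1(x\<^sub>1, \<dots>, x\<^sub>k) = h\<^sub>j(x\<^sub>1, \<dots>, x\<^sub>k\<^sub>+\<^sub>1)\<close>. The Schubert polynomials are well defined because
  the divided differences satisfy the braid relations, which makes any two ascents of a permutation
  confluent.
\<close>

section \<open>Exchanging variables and divided differences\<close>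

abbreviation swap_exps :: "nat \<Rightarrow> (nat \<Rightarrow>\<^sub>0 nat) \<Rightarrow> (nat \<Rightarrow>\<^sub>0 nat)" where
  "swap_exps i \<equiv> Poly_Mapping.map_key (Transposition.transpose i (Suc i))"

lemma lookup_map_key:
  "inj f \<Longrightarrow> Poly_Mapping.lookup (Poly_Mapping.map_key f p) k = Poly_Mapping.lookup p (f k)"
  by (simp add: map_key.rep_eq)

lemma lookup_swap_exps [simp]:
  "Poly_Mapping.lookup (swap_exps i e) k = Poly_Mapping.lookup e (Transposition.transpose i (Suc i) k)"
  by (simp add: lookup_map_key inj_transpose)

lemma swap_exps_swap_exps [simp]: "swap_exps i (swap_exps i e) = e"
  by (rule poly_mapping_eqI) simp

lemma inj_swap_exps [simp]: "inj (swap_exps i)"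
  by (metis injI swap_exps_swap_exps)

lemma swap_exps_add: "swap_exps i (d + e) = swap_exps i d + swap_exps i e"
  by (rule poly_mapping_eqI) (simp add: lookup_add)

lemma lookup_swap_vars:
  "Poly_Mapping.lookup (swap_vars i f) e = Poly_Mapping.lookup f (swap_exps i e)"
  unfolding swap_vars_def by (simp add: lookup_map_key)

lemma swap_vars_add: "swap_vars i (f + g) = swap_vars i f + swap_vars i g"
  by (rule poly_mapping_eqI) (simp add: lookup_swap_vars lookup_add)

lemma swap_vars_diff: "swap_vars i (f - g) = swap_vars i f - swap_vars i g"
  by (rule poly_mapping_eqI) (simp add: lookup_swap_vars lookup_minus)

lemma swap_vars_zero [simp]: "swap_vars i 0 = 0"
  by (rule poly_mapping_eqI) (simp add: lookup_swap_vars)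

lemma swap_vars_single:
  "swap_vars i (Poly_Mapping.single e c) = Poly_Mapping.single (swap_exps i e) c"
  by (rule poly_mapping_eqI) (auto simp: lookup_swap_vars lookup_single when_def)

lemma swap_vars_one [simp]: "swap_vars i 1 = 1"
proof -
  have "swap_exps i 0 = 0" by (rule poly_mapping_eqI) simp
  then show ?thesis
    using swap_vars_single[of i 0 1] by simp
qed

lemma swap_vars_swap_vars [simp]: "swap_vars i (swap_vars i f) = f"
  by (rule poly_mapping_eqI) (simp add: lookup_swap_vars)

text \<open>Both sides are additive in each factor and differences of monomials generate all integer
  polynomials, so \<open>frag_induction\<close> reduces the claim to
  \<open>swap_exps_add\<close>.\<close>

lemma swap_vars_mult: "swap_vars i (f * g) = swap_vars i f * swap_vars i g"
  using subset_UNIV[of "Poly_Mapping.keys f"]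
proof (induction f rule: frag_induction)
  case zero
  then show ?case by simp
next
  case (one d)
  show ?case
    using subset_UNIV[of "Poly_Mapping.keys g"]
  proof (induction g rule: frag_induction)
    case zero
    then show ?case by simp
  next
    case (one e)
    then show ?case by (simp add: mult_single swap_vars_single swap_exps_add)
  next
    case (diff a b)
    then show ?case by (simp add: algebra_simps swap_vars_diff)
  qed
next
  case (diff a b)
  then show ?case by (simp add: algebra_simps swap_vars_diff)
qed

lemma swap_vars_power: "swap_vars i (f ^ k) = swap_vars i f ^ k"
  by (induction k) (simp_all add: swap_vars_mult)

lemma swap_vars_prod: "swap_vars i (prod f A) = (\<Prod>a\<in>A. swap_vars i (f a))"
  by (induction A rule: infinite_finite_induct) (simp_all add: swap_vars_mult)

lemma swap_vars_Var: "swap_vars i (Var j) = Var (Transposition.transpose i (Suc i) j)"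
proof -
  have "swap_exps i (Poly_Mapping.single j 1) = Poly_Mapping.single (Transposition.transpose i (Suc i) j) 1"
    by (rule poly_mapping_eqI) (auto simp: lookup_single when_def Transposition.transpose_def)
  then show ?thesis by (simp add: Var_def swap_vars_single)
qed

lemma swap_vars_commute:
  assumes "Suc i < j"
  shows "swap_vars i (swap_vars j f) = swap_vars j (swap_vars i f)"
proof -
  have "swap_exps j (swap_exps i e) = swap_exps i (swap_exps j e)" for e
    using assms by (intro poly_mapping_eqI) (auto simp: Transposition.transpose_def)
  then show ?thesis by (intro poly_mapping_eqI) (simp add: lookup_swap_vars)
qed

lemma swap_vars_braid:
  "swap_vars i (swap_vars (Suc i) (swap_vars i f)) =
   swap_vars (Suc i) (swap_vars i (swap_vars (Suc i) f))"
proof -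
  have "swap_exps i (swap_exps (Suc i) (swap_exps i e)) =
    swap_exps (Suc i) (swap_exps i (swap_exps (Suc i) e))" for e
    by (intro poly_mapping_eqI) (auto simp: Transposition.transpose_def)
  then show ?thesis by (intro poly_mapping_eqI) (simp add: lookup_swap_vars)
qed

section \<open>Homogeneous polynomials and their exponent vectors\<close>

definition exps :: "nat \<Rightarrow> nat \<Rightarrow> (nat \<Rightarrow>\<^sub>0 nat) set" where
  "exps n d = {e. Poly_Mapping.keys e \<subseteq> {1..n} \<and> (\<Sum>i=1..n. Poly_Mapping.lookup e i) = d}"

lemma exps_mono:
  assumes "n \<le> m"
  shows "exps n d \<subseteq> exps m d"
proof
  fix e assume e: "e \<in> exps n d"
  then have k: "Poly_Mapping.keys e \<subseteq> {1..n}" by (simp add: exps_def)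
  have "(\<Sum>i=1..m. Poly_Mapping.lookup e i) = (\<Sum>i=1..n. Poly_Mapping.lookup e i)"
    using k assms by (intro sum.mono_neutral_right) (auto simp: in_keys_iff)
  then show "e \<in> exps m d" using e k assms by (fastforce simp: exps_def)
qed

lemma keys_add_nat: "Poly_Mapping.keys (d + e) = Poly_Mapping.keys d \<union> Poly_Mapping.keys e"
  for d e :: "'a \<Rightarrow>\<^sub>0 nat"
  by (auto simp: in_keys_iff lookup_add)

lemma exps_add: "d \<in> exps n a \<Longrightarrow> e \<in> exps n b \<Longrightarrow> d + e \<in> exps n (a + b)"
  by (auto simp: exps_def keys_add_nat lookup_add sum.distrib)

lemma single_in_exps: "1 \<le> i \<Longrightarrow> i \<le> n \<Longrightarrow> Poly_Mapping.single i k \<in> exps n k"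
  by (auto simp: exps_def lookup_single when_def)

lemma exps_0: "exps n 0 = {0}"
proof -
  have "e = 0" if "e \<in> exps n 0" for e
    using that by (intro poly_mapping_eqI) (auto simp: exps_def in_keys_iff)
  then show ?thesis by (auto simp: exps_def)
qed

text \<open>Some exponent is positive, so one variable splits off; this drives the induction on the
  degree for divided differences.\<close>

lemma exps_Suc_cases:
  assumes "e \<in> exps n (Suc d)"
  obtains j e' where "1 \<le> j" "j \<le> n" "e' \<in> exps n d" "e = Poly_Mapping.single j 1 + e'"
proof -
  have "\<exists>j\<in>{1..n}. Poly_Mapping.lookup e j \<noteq> 0"
  proof (rule ccontr)
    assume "\<not> ?thesis"
    then have "(\<Sum>i=1..n. Poly_Mapping.lookup e i) = 0" by simp
    then show False using assms by (simp add: exps_def)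
  qed
  then obtain j where j: "j \<in> {1..n}" "Poly_Mapping.lookup e j \<noteq> 0" by blast
  define e' where "e' = e - Poly_Mapping.single j 1"
  have e: "e = Poly_Mapping.single j 1 + e'"
    unfolding e'_def using j by (intro poly_mapping_eqI) (auto simp: lookup_add lookup_minus lookup_single when_def)
  have "Poly_Mapping.keys e' \<subseteq> {1..n}" using assms e keys_add_nat[of "Poly_Mapping.single j 1" e']
    by (auto simp: exps_def)
  moreover have "(\<Sum>i=1..n. Poly_Mapping.lookup e i) = 1 + (\<Sum>i=1..n. Poly_Mapping.lookup e' i)"
    unfolding e using j by (simp add: lookup_add sum.distrib lookup_single when_def)
  ultimately have "e' \<in> exps n d" using assms by (auto simp: exps_def)
  then show thesis using that e j by auto
qed

definition forms :: "nat \<Rightarrow> nat \<Rightarrow> mpoly_int set" where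
  "forms n d = {f. Poly_Mapping.keys f \<subseteq> exps n d}"

lemma forms_diff: "f \<in> forms n d \<Longrightarrow> g \<in> forms n d \<Longrightarrow> f - g \<in> forms n d"
  using keys_diff[of f g] by (auto simp: forms_def)

lemma forms_add: "f \<in> forms n d \<Longrightarrow> g \<in> forms n d \<Longrightarrow> f + g \<in> forms n d"
  using keys_add[of f g] by (auto simp: forms_def)

lemma forms_zero [simp]: "0 \<in> forms n d"
  by (auto simp: forms_def)

lemma forms_one: "1 \<in> forms n 0"
  by (simp add: forms_def exps_0)

lemma forms_mult: "f \<in> forms n a \<Longrightarrow> g \<in> forms n b \<Longrightarrow> f * g \<in> forms n (a + b)"
  using keys_mult[of f g] by (fastforce simp: forms_def intro: exps_add)

lemma forms_Var: "1 \<le> i \<Longrightarrow> i \<le> n \<Longrightarrow> Var i \<in> forms n 1"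
  by (simp add: forms_def Var_def single_in_exps)

lemma forms_power: "f \<in> forms n a \<Longrightarrow> f ^ k \<in> forms n (k * a)"
  by (induction k) (auto simp: forms_one intro!: forms_mult)

lemma forms_prod:
  "(\<And>a. a \<in> A \<Longrightarrow> f a \<in> forms n (d a)) \<Longrightarrow> finite A \<Longrightarrow> prod f A \<in> forms n (sum d A)"
  by (induction A rule: infinite_finite_induct) (auto simp: forms_one intro!: forms_mult)

section \<open>Existence and uniqueness of the exact quotients\<close>

lemma Var_diff_nonzero: "i \<noteq> j \<Longrightarrow> Var i - Var j \<noteq> 0"
proof
  assume ij: "i \<noteq> j" and "Var i - Var j = 0"
  then have "Poly_Mapping.lookup (Var i) (Poly_Mapping.single i 1) = Poly_Mapping.lookup (Var j) (Poly_Mapping.single i 1)"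
    by simp
  moreover have "Poly_Mapping.single i (1::nat) \<noteq> Poly_Mapping.single j 1"
    using ij by (metis keys_single singleton_iff singleton_inject zero_neq_one)
  ultimately show False by (simp add: Var_def lookup_single when_def)
qed

text \<open>Cancelling the nonzero factor x_i - x_(i+1) in an integral domain makes the quotient
  unique, so any exhibited solution is the divided difference.\<close>

lemma divided_difference_eqI:
  assumes "(Var i - Var (Suc i)) * g = f - swap_vars i f"
  shows "divided_difference i f = g"
  unfolding divided_difference_def Suc_eq_plus1[symmetric]
proof (rule the_equality)
  show "(Var i - Var (Suc i)) * g = f - swap_vars i f" by (rule assms)
next
  fix g' assume "(Var i - Var (Suc i)) * g' = f - swap_vars i f"
  then have "(Var i - Var (Suc i)) * g' = (Var i - Var (Suc i)) * g" using assms by simp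
  then show "g' = g" using Var_diff_nonzero[of i "Suc i"] by (metis mult_left_cancel n_not_Suc_n)
qed

text \<open>The induction on the degree uses the Leibniz rule \<open>x\<^sub>j m - s (x\<^sub>j m) = (x\<^sub>j - s x\<^sub>j) m + s x\<^sub>j (m - s m)\<close>.\<close>

lemma divided_difference_monomial_exists:
  assumes "1 \<le> i" "i < n" "e \<in> exps n d"
  shows "\<exists>g \<in> (if d = 0 then {0} else forms n (d - 1)).
    (Var i - Var (Suc i)) * g = Poly_Mapping.single e 1 - swap_vars i (Poly_Mapping.single e 1)"
  using assms(3)
proof (induction d arbitrary: e)
  case 0
  then have "e = 0" by (simp add: exps_0)
  then show ?case by simp
next
  case (Suc d)
  then obtain j e' where j: "1 \<le> j" "j \<le> n" and e': "e' \<in> exps n d" and e: "e = Poly_Mapping.single j 1 + e'"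
    by (elim exps_Suc_cases)
  define m where "m = Poly_Mapping.single e' (1::int)"
  have m: "Poly_Mapping.single e 1 = Var j * m"
    by (simp add: m_def e Var_def mult_single)
  have fm: "m \<in> forms n d" using e' by (simp add: m_def forms_def)
  obtain g where g: "g \<in> (if d = 0 then {0} else forms n (d - 1))"
      "(Var i - Var (Suc i)) * g = m - swap_vars i m"
    using Suc.IH[OF e'] unfolding m_def by blast
  let ?t = "Transposition.transpose i (Suc i) j"
  \<comment> \<open>The product has degree 1 + (d - 1), which is d only for positive d; hence the
    stronger condition g = 0 on constants.\<close>
  have t: "Var ?t * g \<in> forms n d"
  proof (cases "d = 0")
    case False
    have "Var ?t \<in> forms n 1" using j assms(1,2) by (intro forms_Var) (simp_all add: Transposition.transpose_def)
    from forms_mult[OF this] False g(1) show ?thesis by fastforce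
  qed (use g in simp)
  \<comment> \<open>\<open>q\<close> is the quotient of (x_j - s x_j) m by x_i - x_(i+1): the first
    factor is the divisor, its negative, or zero.\<close>
  define q :: mpoly_int where "q = (if j = i then m else if j = Suc i then - m else 0)"
  have q: "(Var i - Var (Suc i)) * q = (Var j - Var ?t) * m"
    by (auto simp: q_def Transposition.transpose_def algebra_simps)
  have qf: "q \<in> forms n d"
    using fm forms_diff[OF forms_zero fm] by (auto simp: q_def)
  have "(Var i - Var (Suc i)) * (q + Var ?t * g) = (Var j - Var ?t) * m + Var ?t * ((Var i - Var (Suc i)) * g)"
    by (simp add: q distrib_left mult.left_commute)
  also have "\<dots> = Var j * m - swap_vars i (Var j * m)"
    unfolding g(2) by (simp add: swap_vars_mult swap_vars_Var algebra_simps)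
  finally show ?case unfolding m using forms_add[OF qf t] by (intro bexI) auto
qed

lemma divided_difference_exists:
  assumes "1 \<le> i" "i < n" "f \<in> forms n d"
  shows "\<exists>g \<in> forms n (d - 1). (Var i - Var (Suc i)) * g = f - swap_vars i f"
proof -
  have "Poly_Mapping.keys f \<subseteq> exps n d" using assms by (simp add: forms_def)
  then show ?thesis
  proof (induction f rule: frag_induction)
    case zero
    then show ?case by (intro bexI[of _ 0]) auto
  next
    case (one e)
    from divided_difference_monomial_exists[OF assms(1,2) one] show ?case by (auto split: if_splits)
  next
    case (diff a b)
    then obtain g h where "g \<in> forms n (d - 1)" "(Var i - Var (Suc i)) * g = a - swap_vars i a"
      "h \<in> forms n (d - 1)" "(Var i - Var (Suc i)) * h = b - swap_vars i b" by blast
    then show ?case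
      by (intro bexI[of _ "g - h"]) (simp_all add: swap_vars_diff right_diff_distrib forms_diff)
  qed
qed

lemma divided_difference_forms:
  assumes "1 \<le> i" "i < n" "f \<in> forms n d"
  shows "divided_difference i f \<in> forms n (d - 1)"
  using divided_difference_exists[OF assms] divided_difference_eqI by blast

lemma divided_difference_mult:
  assumes "1 \<le> i" "i < n" "f \<in> forms n d"
  shows "(Var i - Var (Suc i)) * divided_difference i f = f - swap_vars i f"
  using divided_difference_exists[OF assms] divided_difference_eqI by blast

section \<open>Braid relations\<close>

text \<open>In the application, a and b are simple roots and k = \<partial>_i \<partial>_(i+1)
  \<partial>_i f; the right side is the antisymmetrization of f over S_3. Exchanging s with t and a
  with b changes only the last term, sts into tst, so one abstract identity serves both sides of the
  braid relation.\<close>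

lemma braid_expansion:
  fixes s t :: "'a::idom \<Rightarrow> 'a"
  assumes s: "\<And>x y. s (x * y) = s x * s y" "\<And>x y. s (x - y) = s x - s y"
      "\<And>x y. s (x + y) = s x + s y" "s (s f) = f"
    and t: "\<And>x y. t (x * y) = t x * t y" "\<And>x y. t (x - y) = t x - t y"
    and ab: "s a = - a" "s b = a + b" "t a = a + b" "a \<noteq> 0"
    and g: "a * g = f - s f" and h: "b * h = g - t g" and k: "a * k = h - s h"
  shows "a * b * (a + b) * k = f - s f - t f + t (s f) + s (t f) - s (t (s f))"
proof -
  \<comment> \<open>The quotient g is invariant under s, because s negates both a and f - s
    f.\<close>
  have "- a * s g = s f - f"
    using arg_cong[OF g, of s] by (simp only: s ab)
  then have "a * s g = f - s f" by (simp add: minus_equation_iff[of "a * s g"])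
  then have "a * s g = a * g" by (simp only: g)
  then have sg: "s g = g" using ab by simp
  have tg: "(a + b) * t g = t f - t (s f)"
    using arg_cong[OF g, of t] by (simp only: t ab)
  have stg: "b * s (t g) = s (t f) - s (t (s f))"
    using arg_cong[OF tg, of s] by (simp add: s ab)
  have sh: "(a + b) * s h = g - s (t g)"
    using arg_cong[OF h, of s] by (simp only: s ab sg)
  have "a * b * (a + b) * k = b * (a + b) * (a * k)" by (simp add: algebra_simps)
  also have "\<dots> = (a + b) * (b * h) - b * ((a + b) * s h)"
    unfolding k by (simp add: algebra_simps)
  also have "\<dots> = (a + b) * g - (a + b) * t g - b * g + b * s (t g)"
    unfolding h sh by (simp add: algebra_simps)
  also have "\<dots> = a * g - (a + b) * t g + b * s (t g)"
    by (simp add: algebra_simps)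
  finally show ?thesis unfolding g tg stg by (simp add: algebra_simps)
qed

lemma divided_difference_braid:
  assumes i: "1 \<le> i" "Suc i < n" and f: "f \<in> forms n d"
  shows "divided_difference i (divided_difference (Suc i) (divided_difference i f)) =
    divided_difference (Suc i) (divided_difference i (divided_difference (Suc i) f))"
proof -
  let ?D = divided_difference
  define a b where "a = Var i - Var (Suc i)" and "b = Var (Suc i) - Var (Suc (Suc i))"
  have ab: "swap_vars i a = - a" "swap_vars i b = a + b" "swap_vars (Suc i) a = a + b"
      "swap_vars (Suc i) b = - b"
    by (simp_all add: a_def b_def swap_vars_diff swap_vars_Var Transposition.transpose_def)
  have nz: "a \<noteq> 0" "b \<noteq> 0" "a + b \<noteq> 0"
    using Var_diff_nonzero[of i "Suc i"] Var_diff_nonzero[of "Suc i" "Suc (Suc i)"]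
      Var_diff_nonzero[of i "Suc (Suc i)"] by (simp_all add: a_def b_def)
  have D: "?D i g \<in> forms n (e - 1)" "?D (Suc i) g \<in> forms n (e - 1)"
    "a * ?D i g = g - swap_vars i g" "b * ?D (Suc i) g = g - swap_vars (Suc i) g"
    if "g \<in> forms n e" for g e
    using that i divided_difference_forms[of i n g e] divided_difference_forms[of "Suc i" n g e]
      divided_difference_mult[of i n g e] divided_difference_mult[of "Suc i" n g e]
    by (simp_all add: a_def b_def)
  note D1 = D[OF f]
  note D2 = D(1,3)[OF D1(2)] D(2,4)[OF D1(1)]
  note D3 = D(3)[OF D2(3)] D(4)[OF D2(1)]
  have "a * b * (a + b) * ?D i (?D (Suc i) (?D i f)) =
      f - swap_vars i f - swap_vars (Suc i) f + swap_vars (Suc i) (swap_vars i f)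
      + swap_vars i (swap_vars (Suc i) f) - swap_vars i (swap_vars (Suc i) (swap_vars i f))"
    by (rule braid_expansion[OF swap_vars_mult swap_vars_diff swap_vars_add swap_vars_swap_vars
          swap_vars_mult swap_vars_diff ab(1-3) nz(1) D1(3) D2(4) D3(1)])
  \<comment> \<open>The same expansion with the two exchanges interchanged; the right sides agree by
    \<open>swap_vars_braid\<close>.\<close>
  moreover have "b * a * (b + a) * ?D (Suc i) (?D i (?D (Suc i) f)) =
      f - swap_vars (Suc i) f - swap_vars i f + swap_vars i (swap_vars (Suc i) f)
      + swap_vars (Suc i) (swap_vars i f) - swap_vars (Suc i) (swap_vars i (swap_vars (Suc i) f))"
    using ab by (intro braid_expansion[OF swap_vars_mult swap_vars_diff swap_vars_add swap_vars_swap_vars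
          swap_vars_mult swap_vars_diff _ _ _ nz(2) D1(4) D2(2) D3(2)]) (simp_all add: add.commute)
  ultimately have "a * b * (a + b) * ?D i (?D (Suc i) (?D i f)) =
      a * b * (a + b) * ?D (Suc i) (?D i (?D (Suc i) f))"
    unfolding mult.commute[of b a] add.commute[of b a] swap_vars_braid
    by simp
  then show ?thesis using nz by simp
qed

text \<open>Each exchange fixes the other linear factor, so multiplication by a b turns both sides
  into f - s f - t f + s t f, with commuting s and t.\<close>

lemma divided_difference_commute:
  assumes i: "1 \<le> i" "Suc i < j" "j < n" and f: "f \<in> forms n d"
  shows "divided_difference i (divided_difference j f) = divided_difference j (divided_difference i f)"
proof -
  let ?D = divided_difference
  define a b where "a = Var i - Var (Suc i)" and "b = Var j - Var (Suc j)"
  have ab: "swap_vars i b = b" "swap_vars j a = a"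
    using i by (simp_all add: a_def b_def swap_vars_diff swap_vars_Var Transposition.transpose_def)
  have nz: "a \<noteq> 0" "b \<noteq> 0"
    using Var_diff_nonzero[of i "Suc i"] Var_diff_nonzero[of j "Suc j"] by (simp_all add: a_def b_def)
  have D: "?D i g \<in> forms n (e - 1)" "?D j g \<in> forms n (e - 1)"
    "a * ?D i g = g - swap_vars i g" "b * ?D j g = g - swap_vars j g"
    if "g \<in> forms n e" for g e
    using that i divided_difference_forms[of i n g e] divided_difference_forms[of j n g e]
      divided_difference_mult[of i n g e] divided_difference_mult[of j n g e]
    by (simp_all add: a_def b_def)
  note D1 = D[OF f]
  have "a * b * ?D i (?D j f) = b * ?D j f - swap_vars i (b * ?D j f)"
    unfolding mult.commute[of a b] mult.assoc D(3)[OF D1(2)]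
    by (simp only: swap_vars_mult ab right_diff_distrib)
  also have "\<dots> = a * ?D i f - swap_vars j (a * ?D i f)"
    unfolding D1 by (simp add: swap_vars_diff swap_vars_commute[OF i(2)])
  also have "\<dots> = a * b * ?D j (?D i f)"
    unfolding mult.assoc D(4)[OF D1(1)] by (simp only: swap_vars_mult ab right_diff_distrib)
  finally show ?thesis using nz by simp
qed

section \<open>Existence and uniqueness of Schubert polynomials in a fixed symmetric group\<close>

definition inversions :: "(nat \<Rightarrow> nat) \<Rightarrow> (nat \<times> nat) set" where
  "inversions w = {(i, j). 1 \<le> i \<and> i < j \<and> w i > w j}"

text \<open>A position beyond n is fixed and carries a value larger than all earlier ones, so no
  inversion ends there.\<close>

lemma inversions_subset:
  assumes w: "w permutes {1..n}"
  shows "inversions w \<subseteq> {1..n} \<times> {1..n}"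
proof -
  have "j \<le> n" if ij: "1 \<le> i" "i < j" "w i > w j" for i j
  proof (rule ccontr)
    assume "\<not> j \<le> n"
    then have "w j = j" using w by (auto simp: permutes_def)
    moreover have "w i \<le> max i n"
      using permutes_in_image[OF w, of i] permutes_not_in[OF w, of i] by (cases "i \<in> {1..n}") auto
    ultimately show False using ij \<open>\<not> j \<le> n\<close> by auto
  qed
  then show ?thesis by (force simp: inversions_def)
qed

lemma perm_length_le: "w permutes {1..n} \<Longrightarrow> perm_length w \<le> n * n"
  using card_mono[OF _ inversions_subset, of n w] by (simp add: perm_length_def inversions_def)

lemma permutes_comp_adjacent:
  "w permutes {1..n} \<Longrightarrow> 1 \<le> i \<Longrightarrow> i < n \<Longrightarrow> w \<circ> Transposition.transpose i (Suc i) permutes {1..n}"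
  by (intro permutes_compose permutes_swap_id) auto

text \<open>The swap transports the old inversions along the transposition of positions and creates
  exactly one new inversion, the swapped pair.\<close>

lemma perm_length_ascent:
  assumes w: "w permutes {1..n}" and i: "1 \<le> i" "w i < w (Suc i)"
  shows "perm_length (w \<circ> Transposition.transpose i (Suc i)) = Suc (perm_length w)"
proof -
  let ?t = "Transposition.transpose i (Suc i)"
  have eq: "inversions (w \<circ> ?t) = insert (i, Suc i) (map_prod ?t ?t ` inversions w)" (is "_ = ?R")
  proof (intro set_eqI)
    fix p :: "nat \<times> nat"
    obtain a b where p: "p = (a, b)" by fastforce
    have "(a, b) \<in> map_prod ?t ?t ` inversions w \<longleftrightarrow> (?t a, ?t b) \<in> inversions w"
      by (force simp: image_iff)
    then show "p \<in> inversions (w \<circ> ?t) \<longleftrightarrow> p \<in> ?R"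
      using i by (auto simp: p inversions_def Transposition.transpose_def split: if_splits)
  qed
  have "(i, Suc i) \<notin> map_prod ?t ?t ` inversions w"
    using i by (auto simp: inversions_def Transposition.transpose_def split: if_splits)
  moreover have "finite (inversions w)"
    using inversions_subset[OF w] finite_subset by blast
  moreover have "inj (map_prod ?t ?t)"
    by (simp add: prod.inj_map)
  ultimately have "card (inversions (w \<circ> ?t)) = Suc (card (inversions w))"
    unfolding eq by (simp add: card_image inj_on_subset)
  then show ?thesis by (simp add: perm_length_def inversions_def)
qed

lemma longest_perm_permutes: "longest_perm n permutes {1..n}"
proof (rule bij_imp_permutes)
  show "bij_betw (longest_perm n) {1..n} {1..n}"
    by (rule bij_betw_byWitness[where f' = "longest_perm n"]) (auto simp: longest_perm_def)
qed (auto simp: longest_perm_def)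

lemma perm_length_longest: "perm_length (longest_perm n) = (\<Sum>i=1..n. n - i)"
proof -
  have "inversions (longest_perm n) = (SIGMA i:{1..n}. {i<..n})"
  proof
    show "inversions (longest_perm n) \<subseteq> (SIGMA i:{1..n}. {i<..n})"
      using inversions_subset[OF longest_perm_permutes, of n] by (auto simp: inversions_def)
  qed (auto simp: inversions_def longest_perm_def)
  then show ?thesis
    unfolding perm_length_def inversions_def[symmetric] by simp
qed

text \<open>Strict descent squeezes the values: going right from w 1 \<le> n bounds them above,
  going left from w n \<ge> 1 bounds them below.\<close>

lemma descending_imp_longest:
  assumes w: "w permutes {1..n}" and desc: "\<And>i. 1 \<le> i \<Longrightarrow> i < n \<Longrightarrow> w (Suc i) < w i"
  shows "w = longest_perm n"
proof
  fix i
  show "w i = longest_perm n i"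
  proof (cases "i \<in> {1..n}")
    case True
    have "w i \<le> n + 1 - i" if "1 \<le> i" "i \<le> n" for i
      using that
    proof (induction i rule: nat_induct_at_least)
      case base
      then show ?case using permutes_in_image[OF w, of 1] by auto
    next
      case (Suc i)
      then show ?case using desc[of i] by fastforce
    qed
    moreover have "n + 1 - i \<le> w i" if "i \<le> n" "1 \<le> i" for i
      using that
    proof (induction i rule: inc_induct)
      case base
      then show ?case using permutes_in_image[OF w, of n] by auto
    next
      case (step i)
      then show ?case using desc[of i] by fastforce
    qed
    ultimately show ?thesis using True by (auto simp: longest_perm_def intro!: order.antisym)
  next
    case False
    then show ?thesis using permutes_not_in[OF w] by (auto simp: longest_perm_def)
  qed
qed

section \<open>Chains of ascents up to the longest permutation\<close>

lemma schubert_rel_permutes: "schubert_rel n w f \<Longrightarrow> w permutes {1..n}"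
  by (induction rule: schubert_rel.induct) (use longest_perm_permutes in auto)

lemma schubert_rel_pos: "schubert_rel n w f \<Longrightarrow> 1 \<le> n"
  by (induction rule: schubert_rel.induct) auto

text \<open>Degree and length agree for the longest permutation, and each step lowers both by
  one.\<close>

lemma schubert_rel_forms: "schubert_rel n w f \<Longrightarrow> f \<in> forms n (perm_length w)"
proof (induction rule: schubert_rel.induct)
  case longest
  have "(\<Prod>i=1..n. Var i ^ (n - i)) \<in> forms n (\<Sum>i=1..n. (n - i) * 1)"
    by (intro forms_prod forms_power forms_Var) auto
  then show ?case by (simp add: perm_length_longest)
next
  case (ascent w i f)
  then show ?case
    using divided_difference_forms[OF ascent(2,3), of f "perm_length (w \<circ> Transposition.transpose i (Suc i))"]
      perm_length_ascent[of w n i] by (simp del: comp_apply)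
qed

text \<open>Ascents can be swapped upwards until none is left, which happens only at the longest
  permutation. Since \<open>n * n\<close> bounds the length, the deficit decreases.\<close>

lemma schubert_rel_exists:
  assumes "w permutes {1..n}" "1 \<le> n"
  shows "\<exists>f. schubert_rel n w f"
  using assms(1)
proof (induction "n * n - perm_length w" arbitrary: w rule: less_induct)
  case less
  show ?case
  proof (cases "\<exists>i. 1 \<le> i \<and> i < n \<and> w i < w (Suc i)")
    case True
    then obtain i where i: "1 \<le> i" "i < n" "w i < w (Suc i)" by blast
    let ?v = "w \<circ> Transposition.transpose i (Suc i)"
    have "?v permutes {1..n}" using less.prems i by (intro permutes_comp_adjacent)
    moreover have "perm_length ?v = Suc (perm_length w)" "perm_length ?v \<le> n * n"
      using perm_length_ascent[OF less.prems i(1,3)] perm_length_le[OF calculation] by auto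
    moreover from this have "n * n - perm_length ?v < n * n - perm_length w" by linarith
    ultimately obtain f where "schubert_rel n ?v f"
      using less.hyps[of ?v] by force
    then show ?thesis using schubert_rel.ascent[of w n i f] less.prems i by auto
  next
    case False
    have "w (Suc i) < w i" if "1 \<le> i" "i < n" for i
      using False that inj_eq[OF permutes_inj[OF less.prems], of i "Suc i"]
      by (meson linorder_neqE_nat n_not_Suc_n)
    then have "w = longest_perm n" by (intro descending_imp_longest less.prems)
    then show ?thesis using schubert_rel.longest[OF assms(2)] by auto
  qed
qed

lemma schubert_rel_ascent_cases:
  assumes "schubert_rel n w f"
  obtains "w = longest_perm n" "f = (\<Prod>i=1..n. Var i ^ (n - i))"
  | i g where "1 \<le> i" "i < n" "w i < w (Suc i)" "f = divided_difference i g"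
      "schubert_rel n (w \<circ> Transposition.transpose i (Suc i)) g"
  using assms by cases auto

lemma schubert_rel_ascentI:
  assumes "schubert_rel n v g" "v = w \<circ> Transposition.transpose i (Suc i)"
    and i: "1 \<le> i" "i < n" "w i < w (Suc i)"
  shows "schubert_rel n w (divided_difference i g)"
proof -
  have "w = v \<circ> Transposition.transpose i (Suc i)" by (simp add: assms(2) comp_assoc)
  then have "w permutes {1..n}"
    using permutes_comp_adjacent[OF schubert_rel_permutes[OF assms(1)] i(1,2)] by simp
  then show ?thesis using assms schubert_rel.ascent[of w n i g] by simp
qed

text \<open>Two different ascents are joined by a square if they are far apart and by a hexagon if they
  are adjacent, so uniqueness follows by induction from above.\<close>

lemma schubert_rel_unique:
  assumes "schubert_rel n w f" "schubert_rel n w f'"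
  shows "f = f'"
  using assms
proof (induction "n * n - perm_length w" arbitrary: w f f' rule: less_induct)
  case less
  let ?D = divided_difference
  let ?t = "\<lambda>i. Transposition.transpose i (Suc i)"
  note w = schubert_rel_permutes[OF less.prems(1)]
  have n: "1 \<le> n" by (rule schubert_rel_pos[OF less.prems(1)])
  have IH: "g = g'" if "schubert_rel n (w \<circ> ?t i) g" "schubert_rel n (w \<circ> ?t i) g'"
      "1 \<le> i" "w i < w (Suc i)" for i g g'
  proof (rule less.hyps[OF _ that(1,2)])
    have "perm_length (w \<circ> ?t i) \<le> n * n"
      using perm_length_le[OF schubert_rel_permutes] that by blast
    then show "n * n - perm_length (w \<circ> ?t i) < n * n - perm_length w"
      using perm_length_ascent[OF w that(3,4)] by simp
  qed
  have main: "?D i g = ?D j h"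
    if i: "1 \<le> i" "i < n" "w i < w (Suc i)" "schubert_rel n (w \<circ> ?t i) g"
      and j: "1 \<le> j" "j < n" "w j < w (Suc j)" "schubert_rel n (w \<circ> ?t j) h" and "i < j"
    for i j g h
  proof (cases "j = Suc i")
    case True
    \<comment> \<open>The entries at positions i, i + 1, i + 2 increase; \<open>v\<close> reverses
      them and is the top of the hexagon. The induction hypothesis forces \<open>g\<close> and
      \<open>h\<close> to be the polynomials reached from \<open>p\<close> along its two
      sides.\<close>
    define v where "v = w \<circ> ?t i \<circ> ?t j \<circ> ?t i"
    have v': "v = w \<circ> ?t j \<circ> ?t i \<circ> ?t j"
      by (auto simp: v_def True fun_eq_iff Transposition.transpose_def)
    have "v permutes {1..n}"
      unfolding v_def using w i j by (intro permutes_comp_adjacent)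
    then obtain p where p: "schubert_rel n v p" using schubert_rel_exists n by blast
    have "schubert_rel n (w \<circ> ?t i \<circ> ?t j) (?D i p)"
      by (rule schubert_rel_ascentI[OF p v_def]) (use i j True in \<open>auto simp: Transposition.transpose_def\<close>)
    then have "schubert_rel n (w \<circ> ?t i) (?D j (?D i p))"
      by (rule schubert_rel_ascentI) (use i j True in \<open>auto simp: Transposition.transpose_def\<close>)
    then have g: "g = ?D j (?D i p)" using IH i by blast
    have "schubert_rel n (w \<circ> ?t j \<circ> ?t i) (?D j p)"
      by (rule schubert_rel_ascentI[OF p v']) (use i j True in \<open>auto simp: Transposition.transpose_def\<close>)
    then have "schubert_rel n (w \<circ> ?t j) (?D i (?D j p))"
      by (rule schubert_rel_ascentI) (use i j True in \<open>auto simp: Transposition.transpose_def\<close>)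
    then have h: "h = ?D i (?D j p)" using IH j by blast
    show ?thesis
      unfolding g h True using i j True
      by (intro divided_difference_braid[OF _ _ schubert_rel_forms[OF p]]) auto
  next
    case False
    with \<open>i < j\<close> have ij: "Suc i < j" by simp
    \<comment> \<open>Here the two swaps commute, and \<open>v\<close> is the top of a
      square.\<close>
    define v where "v = w \<circ> ?t i \<circ> ?t j"
    have v': "v = w \<circ> ?t j \<circ> ?t i"
      using ij by (auto simp: v_def fun_eq_iff Transposition.transpose_def)
    have "v permutes {1..n}"
      unfolding v_def using w i j by (intro permutes_comp_adjacent)
    then obtain p where p: "schubert_rel n v p" using schubert_rel_exists n by blast
    have "schubert_rel n (w \<circ> ?t i) (?D j p)"
      by (rule schubert_rel_ascentI[OF p v_def]) (use i j ij in \<open>auto simp: Transposition.transpose_def\<close>)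
    then have g: "g = ?D j p" using IH i by blast
    have "schubert_rel n (w \<circ> ?t j) (?D i p)"
      by (rule schubert_rel_ascentI[OF p v']) (use i j ij in \<open>auto simp: Transposition.transpose_def\<close>)
    then have h: "h = ?D i p" using IH j by blast
    show ?thesis
      unfolding g h using i j ij
      by (intro divided_difference_commute[OF _ _ _ schubert_rel_forms[OF p]]) auto
  qed
  have nl: "w \<noteq> longest_perm n" if "1 \<le> i" "i < n" "w i < w (Suc i)" for i
    using that by (auto simp: longest_perm_def)
  from less.prems(1) show ?case
  proof (cases rule: schubert_rel_ascent_cases)
    case 1
    from less.prems(2) show ?thesis
      by (cases rule: schubert_rel_ascent_cases) (use 1 nl in blast)+
  next
    case i: (2 i g)
    from less.prems(2) show ?thesis
    proof (cases rule: schubert_rel_ascent_cases)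
      case 1
      then show ?thesis using i nl by blast
    next
      case j: (2 j h)
      show ?thesis
      proof (cases i j rule: linorder_cases)
        case less
        show ?thesis unfolding i(4) j(4) by (rule main[OF i(1-3,5) j(1-3,5) less])
      next
        case equal
        then show ?thesis using IH[OF i(5), of h] i j by simp
      next
        case greater
        show ?thesis unfolding i(4) j(4) by (rule main[OF j(1-3,5) i(1-3,5) greater, symmetric])
      qed
    qed
  qed
qed

section \<open>Stability and complete homogeneous polynomials\<close>

definition var_monom :: "nat \<Rightarrow> (nat \<Rightarrow> nat) \<Rightarrow> mpoly_int" where
  "var_monom n c = (\<Prod>i=1..n. Var i ^ c i)"

text \<open>The monomial is x_i times a factor symmetric in x_i and x_(i+1), and \<partial>_i x_i =
  1.\<close>

lemma divided_difference_var_monom: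
  assumes i: "1 \<le> i" "i < n" and c: "c i = Suc (c (Suc i))"
  shows "divided_difference i (var_monom n c) = var_monom n (c(i := c (Suc i)))"
proof (rule divided_difference_eqI)
  let ?A = "{1..n} - {i, Suc i}"
  define R where "R = (\<Prod>j\<in>?A. Var j ^ c j)"
  have split: "(\<Prod>j=1..n. f j) = f i * f (Suc i) * (\<Prod>j\<in>?A. f j)" for f :: "nat \<Rightarrow> mpoly_int"
    using i by (subst prod.subset_diff[of "{i, Suc i}"]) (auto simp: mult.commute)
  have m: "var_monom n c = Var i ^ Suc (c (Suc i)) * Var (Suc i) ^ c (Suc i) * R"
    unfolding var_monom_def split c R_def by simp
  have m': "var_monom n (c(i := c (Suc i))) = Var i ^ c (Suc i) * Var (Suc i) ^ c (Suc i) * R"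
    unfolding var_monom_def split R_def by simp
  have "swap_vars i R = R"
    unfolding R_def swap_vars_prod
    by (intro prod.cong) (auto simp: swap_vars_power swap_vars_Var Transposition.transpose_def)
  then show "(Var i - Var (Suc i)) * var_monom n (c(i := c (Suc i))) = var_monom n c - swap_vars i (var_monom n c)"
    unfolding m m' by (simp add: swap_vars_mult swap_vars_power swap_vars_Var algebra_simps)
qed

text \<open>For p \<le> q this is the effect of the adjacent swaps that carry the entry at position
  p to position q.\<close>

definition rotate_positions :: "(nat \<Rightarrow> nat) \<Rightarrow> nat \<Rightarrow> nat \<Rightarrow> nat \<Rightarrow> nat" where
  "rotate_positions w p q j = (if p \<le> j \<and> j < q then w (Suc j) else if j = q then w p else w j)"

text \<open>The moving entry exceeds those it passes, so each swap turns a descent into an ascent;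
  exponents falling by one at a time keep the monomial rule applicable.\<close>

lemma schubert_rel_rotate:
  assumes "schubert_rel n w (var_monom n c)" "1 \<le> p"
    and "p \<le> q" "q \<le> n" "\<And>j. p < j \<Longrightarrow> j \<le> q \<Longrightarrow> w j < w p"
    and "\<And>j. p \<le> j \<Longrightarrow> j < q \<Longrightarrow> c j = Suc (c (Suc j))"
  shows "schubert_rel n (rotate_positions w p q)
    (var_monom n (\<lambda>j. if p \<le> j \<and> j < q then c (Suc j) else c j))"
  using assms(3-)
proof (induction q rule: dec_induct)
  case base
  have "rotate_positions w p p = w" by (auto simp: rotate_positions_def)
  moreover have "(\<lambda>j. if p \<le> j \<and> j < p then c (Suc j) else c j) = c" by auto
  ultimately show ?case using assms(1) by simp
next
  case (step q)
  define d where "d = (\<lambda>j. if p \<le> j \<and> j < q then c (Suc j) else c j)"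
  have rel: "schubert_rel n (rotate_positions w p q) (var_monom n d)"
    unfolding d_def by (rule step.IH) (use step.prems in auto)
  have dq: "d q = Suc (d (Suc q))"
    using step.prems(3)[of q] step.hyps by (simp add: d_def)
  have "schubert_rel n (rotate_positions w p (Suc q)) (divided_difference q (var_monom n d))"
  proof (rule schubert_rel_ascentI[OF rel])
    show "rotate_positions w p q = rotate_positions w p (Suc q) \<circ> Transposition.transpose q (Suc q)"
      using step.hyps by (auto simp: fun_eq_iff rotate_positions_def Transposition.transpose_def)
    show "rotate_positions w p (Suc q) q < rotate_positions w p (Suc q) (Suc q)"
      using step.prems(2)[of "Suc q"] step.hyps by (simp add: rotate_positions_def)
  qed (use step assms(2) in auto)
  also have "divided_difference q (var_monom n d) = var_monom n (d(q := d (Suc q)))"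
    using dq step assms(2) by (intro divided_difference_var_monom) auto
  also have "d(q := d (Suc q)) = (\<lambda>j. if p \<le> j \<and> j < Suc q then c (Suc j) else c j)"
    using step.hyps by (auto simp: d_def fun_eq_iff)
  finally show ?case .
qed

text \<open>Ascent steps carry over, so only the longest permutation of S_n matters. It arises from
  that of S_(n+1) by moving the entry n + 1 from first to last place, which lowers the exponent of
  x_j from n + 1 - j to n - j.\<close>

lemma schubert_rel_Suc:
  assumes "schubert_rel n w f"
  shows "schubert_rel (Suc n) w f"
  using assms
proof (induction rule: schubert_rel.induct)
  case longest
  have "schubert_rel (Suc n) (longest_perm (Suc n)) (var_monom (Suc n) (\<lambda>i. Suc n - i))"
    using schubert_rel.longest[of "Suc n"] by (simp add: var_monom_def)
  then have "schubert_rel (Suc n) (rotate_positions (longest_perm (Suc n)) 1 (Suc n))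
     (var_monom (Suc n) (\<lambda>j. if 1 \<le> j \<and> j < Suc n then Suc n - Suc j else Suc n - j))"
    by (rule schubert_rel_rotate) (auto simp: longest_perm_def)
  moreover have "rotate_positions (longest_perm (Suc n)) 1 (Suc n) = longest_perm n"
    by (auto simp: fun_eq_iff rotate_positions_def longest_perm_def)
  moreover have "var_monom (Suc n) (\<lambda>j. if 1 \<le> j \<and> j < Suc n then Suc n - Suc j else Suc n - j)
      = (\<Prod>i=1..n. Var i ^ (n - i))"
    by (simp add: var_monom_def)
  ultimately show ?case by simp
next
  case (ascent w i f)
  then have "w permutes {1..Suc n}" by (auto elim: permutes_subset)
  then show ?case using ascent schubert_rel.ascent[of w "Suc n" i f] by (simp del: comp_apply add: comp_def)
qed

lemma schubert_rel_mono: "n \<le> m \<Longrightarrow> schubert_rel n w f \<Longrightarrow> schubert_rel m w f"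
  by (induction m rule: dec_induct) (auto intro: schubert_rel_Suc)

text \<open>Derivations in two symmetric groups are lifted to the larger one, where uniqueness
  applies.\<close>

lemma schubert_eqI:
  assumes "schubert_rel n w f"
  shows "schubert w = f"
  unfolding schubert_def
proof (rule the_equality)
  fix g assume "\<exists>k. schubert_rel k w g"
  then obtain k where "schubert_rel k w g" by blast
  then have "schubert_rel (max n k) w g" "schubert_rel (max n k) w f"
    using assms by (auto intro: schubert_rel_mono[rotated])
  then show "g = f" by (rule schubert_rel_unique)
qed (use assms in blast)

text \<open>The permutation constructed is N, 1, 2, ..., N - 1; only its first entry is recorded, as
  this is what the later swaps use.\<close>

lemma schubert_rel_Var_power:
  assumes "1 \<le> N"
  shows "\<exists>w. w 1 = N \<and> schubert_rel N w (Var 1 ^ (N - 1))"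
proof -
  \<comment> \<open>Stage k, running from N down to 1: positions 2 to k still decrease, with
    exponents k - i there and 0 beyond by truncated subtraction.\<close>
  have "\<exists>w. w 1 = N \<and> (\<forall>i j. 2 \<le> i \<longrightarrow> i < j \<longrightarrow> j \<le> k \<longrightarrow> w j < w i) \<and>
      schubert_rel N w (var_monom N (\<lambda>i. if i = 1 then N - 1 else k - i))"
    if "k \<le> N" "1 \<le> k" for k
    using that
  proof (induction k rule: inc_induct)
    case base
    have "(\<lambda>i. if i = 1 then N - 1 else N - i) = (\<lambda>i. N - i)" by auto
    then have "schubert_rel N (longest_perm N) (var_monom N (\<lambda>i. if i = 1 then N - 1 else N - i))"
      using schubert_rel.longest[OF assms] by (simp add: var_monom_def)
    moreover have "longest_perm N 1 = N"
        "\<forall>i j. 2 \<le> i \<longrightarrow> i < j \<longrightarrow> j \<le> N \<longrightarrow> longest_perm N j < longest_perm N i"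
      using assms by (auto simp: longest_perm_def)
    ultimately show ?case by blast
  next
    case (step k)
    then obtain w where w: "w 1 = N" "\<And>i j. 2 \<le> i \<Longrightarrow> i < j \<Longrightarrow> j \<le> Suc k \<Longrightarrow> w j < w i"
      "schubert_rel N w (var_monom N (\<lambda>i. if i = 1 then N - 1 else Suc k - i))" by auto
    \<comment> \<open>The largest entry among positions 2 to k + 1 is at position 2; it moves behind
      the others.\<close>
    define v where "v = rotate_positions w 2 (Suc k)"
    have "schubert_rel N v (var_monom N (\<lambda>j. if 2 \<le> j \<and> j < Suc k
        then (if Suc j = 1 then N - 1 else Suc k - Suc j) else (if j = 1 then N - 1 else Suc k - j)))"
      unfolding v_def by (rule schubert_rel_rotate[OF w(3)]) (use step w(2) in auto)
    also have "var_monom N (\<lambda>j. if 2 \<le> j \<and> j < Suc k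
        then (if Suc j = 1 then N - 1 else Suc k - Suc j) else (if j = 1 then N - 1 else Suc k - j))
        = var_monom N (\<lambda>i. if i = 1 then N - 1 else k - i)"
      unfolding var_monom_def by (intro prod.cong) auto
    finally have "schubert_rel N v (var_monom N (\<lambda>i. if i = 1 then N - 1 else k - i))" .
    moreover have "v 1 = N" using w(1) step.prems by (auto simp: v_def rotate_positions_def)
    moreover have "v j < v i" if "2 \<le> i" "i < j" "j \<le> k" for i j
      using w(2)[of "Suc i" "Suc j"] that by (auto simp: v_def rotate_positions_def)
    ultimately show ?case by blast
  qed
  from this[of 1] obtain w where w: "w 1 = N"
    "schubert_rel N w (var_monom N (\<lambda>i. if i = 1 then N - 1 else 1 - i))"
    using assms by auto
  have "var_monom N (\<lambda>i. if i = 1 then N - 1 else 1 - i) = (\<Prod>i\<in>{1}. Var i ^ (N - 1))"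
    unfolding var_monom_def using assms by (intro prod.mono_neutral_cong_right) auto
  then show ?thesis using w by auto
qed

section \<open>Complete homogeneous polynomials and their divided differences\<close>

text \<open>The recursion splits monomials by whether the last variable occurs. With a general
  sequence \<open>x\<close>, an exchange of variables acts by replacing the sequence.\<close>

fun complete_sym :: "(nat \<Rightarrow> 'a::comm_ring_1) \<Rightarrow> nat \<Rightarrow> nat \<Rightarrow> 'a" where
  "complete_sym x 0 m = 1"
| "complete_sym x (Suc k) 0 = 0"
| "complete_sym x (Suc k) (Suc m) = complete_sym x (Suc k) m + x (Suc m) * complete_sym x k (Suc m)"

lemma complete_sym_cong:
  "(\<And>i. 1 \<le> i \<Longrightarrow> i \<le> m \<Longrightarrow> x i = y i) \<Longrightarrow> complete_sym x k m = complete_sym y k m"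
  by (induction x k m rule: complete_sym.induct) auto

lemma swap_vars_complete_sym:
  "swap_vars i (complete_sym x k m) = complete_sym (swap_vars i \<circ> x) k m"
  by (induction x k m rule: complete_sym.induct) (auto simp: swap_vars_add swap_vars_mult)

text \<open>Splitting off the last variable gives, by induction on k, h_(k+1)(X, a) - h_(k+1)(X, b)
  = (a - b) h_k(X, a, b), where \<open>y\<close> has b in place of a.\<close>

lemma complete_sym_diff:
  assumes "\<And>j. 1 \<le> j \<Longrightarrow> j \<le> m \<Longrightarrow> y j = x j" "y (Suc m) = x (Suc (Suc m))"
  shows "complete_sym x (Suc k) (Suc m) - complete_sym y (Suc k) (Suc m) =
    (x (Suc m) - x (Suc (Suc m))) * complete_sym x k (Suc (Suc m))"
proof (induction k)
  case 0
  then show ?case using assms complete_sym_cong[of m y x "Suc 0"] by (simp del: complete_sym.simps(2))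
next
  case (Suc k)
  let ?a = "x (Suc m)" and ?b = "x (Suc (Suc m))"
  let ?p = "complete_sym x (Suc k) (Suc m)" and ?q = "complete_sym y (Suc k) (Suc m)"
  have "complete_sym x (Suc (Suc k)) (Suc m) - complete_sym y (Suc (Suc k)) (Suc m) = ?a * ?p - ?b * ?q"
    unfolding complete_sym.simps(3)[of x "Suc k"] complete_sym.simps(3)[of y "Suc k"]
    using assms complete_sym_cong[of m y x "Suc (Suc k)"] by simp
  \<comment> \<open>Adding and subtracting b p exposes the difference from the induction hypothesis;
    the bracket that results is the recursion for h_(k+1)(X, a, b).\<close>
  also have "\<dots> = (?a - ?b) * ?p + ?b * (?p - ?q)" by (simp only: algebra_simps)
  also have "\<dots> = (?a - ?b) * (?p + ?b * complete_sym x k (Suc (Suc m)))"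
    unfolding Suc.IH by (simp only: algebra_simps)
  finally show ?case by simp
qed

text \<open>Among x_1, ..., x_i the exchange affects only x_i, so the difference formula applies
  with a = x_i and b = x_(i+1).\<close>

lemma divided_difference_complete_sym:
  assumes "1 \<le> i"
  shows "divided_difference i (complete_sym Var (Suc k) i) = complete_sym Var k (Suc i)"
proof (rule divided_difference_eqI)
  obtain m where i: "i = Suc m" using assms by (cases i) auto
  show "(Var i - Var (Suc i)) * complete_sym Var k (Suc i) =
      complete_sym Var (Suc k) i - swap_vars i (complete_sym Var (Suc k) i)"
    unfolding i swap_vars_complete_sym
    by (rule complete_sym_diff[symmetric]) (auto simp: swap_vars_Var Transposition.transpose_def)
qed

lemma complete_sym_1: "complete_sym x k (Suc 0) = x (Suc 0) ^ k"
  by (induction k) auto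

text \<open>The entry N travels right. Being maximal, it leaves an ascent behind after each swap,
  and each divided difference trades one degree for one more variable.\<close>

lemma schubert_rel_complete_sym:
  assumes "1 \<le> k" "k \<le> N"
  shows "\<exists>w. w k = N \<and> schubert_rel N w (complete_sym Var (N - k) k)"
  using assms
proof (induction k rule: nat_induct_at_least)
  case base
  then show ?case using schubert_rel_Var_power[of N] by (simp add: complete_sym_1)
next
  case (Suc k)
  then obtain w where w: "w k = N" "schubert_rel N w (complete_sym Var (N - k) k)" by auto
  define v where "v = w \<circ> Transposition.transpose k (Suc k)"
  note p = schubert_rel_permutes[OF w(2)]
  have "w (Suc k) \<in> {1..N}" using permutes_in_image[OF p, of "Suc k"] Suc by auto
  moreover have "w (Suc k) \<noteq> w k" using inj_eq[OF permutes_inj[OF p]] by simp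
  ultimately have "v k < v (Suc k)" using w by (simp add: v_def)
  then have "schubert_rel N v (divided_difference k (complete_sym Var (N - k) k))"
    using Suc by (intro schubert_rel_ascentI[OF w(2)]) (auto simp: v_def comp_assoc)
  moreover have "N - k = Suc (N - Suc k)" using Suc by simp
  ultimately have "schubert_rel N v (complete_sym Var (N - Suc k) (Suc k))"
    using divided_difference_complete_sym[OF Suc.hyps(1)] by simp
  moreover have "v (Suc k) = N" using w by (simp add: v_def)
  ultimately show ?case by blast
qed

section \<open>Support of the complete homogeneous polynomials\<close>

text \<open>Exponent subtraction truncates: if x_i does not divide the monomial,
  \<open>e - Poly_Mapping.single i 1\<close> is \<open>e\<close> itself, so this case is
  separated.\<close>

lemma lookup_Var_mult:
  "Poly_Mapping.lookup (Var i * p) e =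
    (if Poly_Mapping.lookup e i = 0 then 0 else Poly_Mapping.lookup p (e - Poly_Mapping.single i 1))"
  using subset_UNIV[of "Poly_Mapping.keys p"]
proof (induction p rule: frag_induction)
  case zero
  then show ?case by simp
next
  case (one d)
  have "Poly_Mapping.single i 1 + d = e \<longleftrightarrow> Poly_Mapping.lookup e i \<noteq> 0 \<and> d = e - Poly_Mapping.single i 1"
    by (auto simp: poly_mapping_eq_iff fun_eq_iff lookup_add lookup_minus lookup_single when_def split: if_splits)
  then show ?case by (auto simp: Var_def mult_single lookup_single when_def)
next
  case (diff a b)
  then show ?case by (simp add: right_diff_distrib lookup_minus)
qed

lemma exps_Suc_left:
  assumes "Poly_Mapping.lookup e (Suc m) = 0"
  shows "e \<in> exps (Suc m) d \<longleftrightarrow> e \<in> exps m d"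
proof -
  have "Poly_Mapping.keys e \<subseteq> {1..m}" if "Poly_Mapping.keys e \<subseteq> {1..Suc m}"
  proof
    fix k assume "k \<in> Poly_Mapping.keys e"
    then have "k \<in> {1..Suc m}" "k \<noteq> Suc m" using that assms by (blast, auto simp: in_keys_iff)
    then show "k \<in> {1..m}" by auto
  qed
  then show ?thesis using assms by (fastforce simp: exps_def)
qed

lemma exps_Suc_right:
  assumes "Poly_Mapping.lookup e (Suc m) \<noteq> 0"
  shows "e \<in> exps (Suc m) (Suc d) \<longleftrightarrow> e - Poly_Mapping.single (Suc m) 1 \<in> exps (Suc m) d"
proof -
  define e' where "e' = e - Poly_Mapping.single (Suc m) 1"
  have e: "e = Poly_Mapping.single (Suc m) 1 + e'"
    unfolding e'_def using assms
    by (intro poly_mapping_eqI) (auto simp: lookup_add lookup_minus lookup_single when_def)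
  have "e \<in> exps (Suc m) (Suc d) \<longleftrightarrow> e' \<in> exps (Suc m) d"
    unfolding e by (auto simp: exps_def keys_add_nat lookup_add sum.distrib lookup_single when_def)
  then show ?thesis by (simp only: e'_def)
qed

text \<open>The two summands of the recursion have disjoint supports, told apart by divisibility by
  x_(m+1), so coefficients never add up.\<close>

lemma lookup_complete_sym:
  "Poly_Mapping.lookup (complete_sym Var k m) e = (if e \<in> exps m k then 1 else 0)"
proof (induction "Var :: nat \<Rightarrow> mpoly_int" k m arbitrary: e rule: complete_sym.induct)
  case (1 m)
  show ?case by (auto simp: exps_0 lookup_one)
next
  case (2 k)
  then show ?case by (simp add: exps_def)
next
  case (3 k m)
  have "e \<notin> exps m (Suc k)" if "Poly_Mapping.lookup e (Suc m) \<noteq> 0"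
    using that by (auto simp: exps_def in_keys_iff subset_iff)
  then show ?case
    by (simp add: lookup_add lookup_Var_mult 3 exps_Suc_left exps_Suc_right)
qed

lemma keys_complete_sym: "Poly_Mapping.keys (complete_sym Var k m) = exps m k"
  by (auto simp: in_keys_iff lookup_complete_sym split: if_splits)

section \<open>Domination of Newton polytopes\<close>

lemma keys_schubert_subset:
  assumes "schubert_rel n u f" "n \<le> m"
  shows "Poly_Mapping.keys (schubert u) \<subseteq> exps m (perm_length u)"
  using schubert_rel_forms[OF assms(1)] exps_mono[OF assms(2)] schubert_eqI[OF assms(1)]
  by (auto simp: forms_def)

lemma newton_mono: "Poly_Mapping.keys f \<subseteq> Poly_Mapping.keys g \<Longrightarrow> newton f \<subseteq> newton g"
  unfolding newton_def by (intro hull_mono image_mono)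

lemma S_inf_schubert_rel:
  assumes "u \<in> S_inf"
  obtains n f where "1 \<le> n" "schubert_rel n u f"
  using assms schubert_rel_exists by (force simp: S_inf_def)

theorem theorem5p12:
  fixes l :: nat and u v :: "nat \<Rightarrow> nat"
  assumes "u \<in> S_inf_len l" and "v \<in> S_inf_len l"
  shows "\<exists>w \<in> S_inf_len l. u \<preceq>\<^sub>D w \<and> v \<preceq>\<^sub>D w"
proof -
  obtain n f where u: "1 \<le> n" "schubert_rel n u f"
    using assms by (auto simp: S_inf_len_def elim: S_inf_schubert_rel)
  obtain k g where v: "1 \<le> k" "schubert_rel k v g"
    using assms by (auto simp: S_inf_len_def elim: S_inf_schubert_rel)
  \<comment> \<open>Both given polynomials involve only x_1, ..., x_m.\<close>
  define m where "m = max n k"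
  have m: "1 \<le> m" using u(1) by (auto simp: m_def)
  \<comment> \<open>With N = m + l, the entry N at position m leaves degree N - m = l.\<close>
  obtain w where w: "schubert_rel (m + l) w (complete_sym Var l m)"
    using schubert_rel_complete_sym[of m "m + l"] m by auto
  have keys: "Poly_Mapping.keys (schubert w) = exps m l"
    by (simp add: schubert_eqI[OF w] keys_complete_sym)
  \<comment> \<open>The length of \<open>w\<close> is read off from its polynomial: x_1^l occurs
    there, and all monomials have degree \<open>perm_length w\<close>.\<close>
  have "Poly_Mapping.single 1 l \<in> exps m l" using m by (intro single_in_exps) auto
  then have "Poly_Mapping.single 1 l \<in> exps (m + l) l" "Poly_Mapping.single 1 l \<in> exps (m + l) (perm_length w)"
    using exps_mono[of m "m + l" l] keys_schubert_subset[OF w, of "m + l"] keys by auto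
  then have "perm_length w = l" by (simp add: exps_def)
  moreover have "w \<in> S_inf" using schubert_rel_permutes[OF w] schubert_rel_pos[OF w] by (auto simp: S_inf_def)
  moreover have "u \<preceq>\<^sub>D w" "v \<preceq>\<^sub>D w"
    using keys_schubert_subset[OF u(2), of m] keys_schubert_subset[OF v(2), of m] assms
    by (auto simp: le_D_def S_inf_len_def m_def keys intro!: newton_mono)
  ultimately show ?thesis by (auto simp: S_inf_len_def)
qed

end
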